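(* Let $0<b_1<b_2<1$. The stochastic six-vertex model speed process $(U(x))_{x\in\mathbb{Z}}$ with parameters $b_1,b_2$ is ergodic with respect to translations of $\mathbb{Z}$ (i.e. its law on $\mathbb{R}^{\mathbb{Z}}$ is invariant and ergodic under the shift).
   Context: Multi-class stochastic six-vertex model on the line: each vertex $(x,t)\in\mathbb{Z}\times\mathbb{Z}_{\ge0}$ has two incoming edges (bottom, left) and two outgoing edges (top, right). Every edge carries a class in $\mathbb{R}\cup\{-\infty,\infty\}$ (class $\infty$ is a hole). Let $(\chi^1(x,t))$ and $(\chi^2(x,t))$, $x\in\mathbb{Z},t\in\mathbb{Z}_{\ge0}$, be independent families of i.i.d. Bernoulli$(b_1)$ and Bernoulli$(b_2)$ random variables. At vertex $(x,t)$ with incoming classes $a$ from the bottom and $c$ from the left: if $a=c$, both outgoing edges have this class; if $a<c$, then $a$ exits through the top and $c$ through the right when $\chi^1(x,t)=1$, and $a$ exits through the right and $c$ through the top when $\chi^1(x,t)=0$; if $c<a$, then $c$ exits through the right and $a$ through the top when $\chi^2(x,t)=1$, and $c$ exits through the top and $a$ through the right when $\chi^2(x,t)=0$. Given the classes $\eta_0(x)$ of the edges entering $(x,0)$ from below, there is almost surely a unique assignment of classes to all edges consistent with these rules (in each row there are almost surely vertices with $\chi^1=\chi^2=0$ arbitrarily far to the left, and there the bottom class always exits right and the left class always exits through the top). For $t\ge0$, $\eta_t(x)$ is the class of the edge entering $(x,t)$ from below. Speed process: start from packed initial conditions $\eta_0(x)=x$ for all $x\in\mathbb{Z}$ and let $\bm{X}_t(x)$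 be the position of the unique particle of class $x$ at time $t$ (so $\eta_t(\bm{X}_t(x))=x$). Almost surely $U(x)=\lim_{t\to\infty}\bm{X}_t(x)/t$ exists for all $x\in\mathbb{Z}$; the process $(U(x))_{x\in\mathbb{Z}}$ is the stochastic six-vertex model speed process. *)

theory Defs
  imports "HOL-Probability.Probability"
begin

text \<open>Classes of edges are extended reals; \<open>\<infinity>\<close> is a hole. \<open>vertex_out u v a c\<close> is the pair
  (class on the top edge, class on the right edge) for bottom class \<open>a\<close>, left class \<open>c\<close> and values
  \<open>u\<close>, \<open>v\<close> of \<open>\<chi>\<^sup>1\<close>, \<open>\<chi>\<^sup>2\<close> at the vertex, where \<open>True\<close> stands for 1.\<close>

definition vertex_out :: "bool \<Rightarrow> bool \<Rightarrow> ereal \<Rightarrow> ereal \<Rightarrow> ereal \<times> ereal" where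
  "vertex_out u v a c =
    (if a = c then (a, c)
     else if a < c then (if u then (a, c) else (c, a))
     else (if v then (a, c) else (c, a)))"

text \<open>\<open>\<eta> t x\<close> and \<open>\<kappa> t x\<close> are the classes of the edges entering the vertex \<open>(x, t)\<close> from below and
  from the left. The top edge of \<open>(x, t)\<close> is the bottom edge of \<open>(x, t + 1)\<close>, and its right edge is
  the left edge of \<open>(x + 1, t)\<close>.\<close>

definition s6v_assignment ::
    "(int \<Rightarrow> nat \<Rightarrow> bool) \<Rightarrow> (int \<Rightarrow> nat \<Rightarrow> bool) \<Rightarrow> (int \<Rightarrow> ereal) \<Rightarrow>
     (nat \<Rightarrow> int \<Rightarrow> ereal) \<Rightarrow> (nat \<Rightarrow> int \<Rightarrow> ereal) \<Rightarrow> bool" where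
  "s6v_assignment u v \<eta>\<^sub>0 \<eta> \<kappa> \<longleftrightarrow>
     \<eta> 0 = \<eta>\<^sub>0 \<and>
     (\<forall>x t. (\<eta> (Suc t) x, \<kappa> t (x + 1)) = vertex_out (u x t) (v x t) (\<eta> t x) (\<kappa> t x))"

text \<open>The definite descriptions below denote the intended objects for almost every realisation
  \<open>u\<close>, \<open>v\<close> of the two Bernoulli families; on the exceptional null event they are unspecified.\<close>

definition s6v_config ::
    "(int \<Rightarrow> nat \<Rightarrow> bool) \<Rightarrow> (int \<Rightarrow> nat \<Rightarrow> bool) \<Rightarrow> (int \<Rightarrow> ereal) \<Rightarrow> nat \<Rightarrow> int \<Rightarrow> ereal" where
  "s6v_config u v \<eta>\<^sub>0 = fst (THE (\<eta>, \<kappa>). s6v_assignment u v \<eta>\<^sub>0 \<eta> \<kappa>)"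

definition packed :: "int \<Rightarrow> ereal" where
  "packed x = ereal (real_of_int x)"

definition s6v_position :: "(int \<Rightarrow> nat \<Rightarrow> bool) \<Rightarrow> (int \<Rightarrow> nat \<Rightarrow> bool) \<Rightarrow> nat \<Rightarrow> int \<Rightarrow> int" where
  "s6v_position u v t x = (THE y. s6v_config u v packed t y = packed x)"

definition s6v_speed :: "(int \<Rightarrow> nat \<Rightarrow> bool) \<Rightarrow> (int \<Rightarrow> nat \<Rightarrow> bool) \<Rightarrow> int \<Rightarrow> real" where
  "s6v_speed u v x = lim (\<lambda>t. real_of_int (s6v_position u v t x) / real t)"

text \<open>Joint independence over the disjoint union of the two index sets expresses that each family
  consists of independent variables and that the two families are independent of each other.\<close>

definition bernoulli_families ::
    "'w measure \<Rightarrow> real \<Rightarrow> real \<Rightarrow> (int \<Rightarrow> nat \<Rightarrow> 'w \<Rightarrow> bool) \<Rightarrow> (int \<Rightarrow> nat \<Rightarrow> 'w \<Rightarrow> bool) \<Rightarrow> bool" where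
  "bernoulli_families M b\<^sub>1 b\<^sub>2 \<chi>\<^sub>1 \<chi>\<^sub>2 \<longleftrightarrow>
     prob_space.indep_vars M (\<lambda>_. count_space UNIV) (case_sum (case_prod \<chi>\<^sub>1) (case_prod \<chi>\<^sub>2)) UNIV \<and>
     (\<forall>x t. distr M (count_space UNIV) (\<chi>\<^sub>1 x t) = measure_pmf (bernoulli_pmf b\<^sub>1)) \<and>
     (\<forall>x t. distr M (count_space UNIV) (\<chi>\<^sub>2 x t) = measure_pmf (bernoulli_pmf b\<^sub>2))"

text \<open>\<open>U\<close> is a version of the speed process: its coordinates are random variables, and almost surely
  they are the limits of \<open>X\<^sub>t(x) / t\<close>. Equality is required only almost surely because the limits are
  only defined almost surely.\<close>

definition s6v_speed_process ::
    "'w measure \<Rightarrow> (int \<Rightarrow> nat \<Rightarrow> 'w \<Rightarrow> bool) \<Rightarrow> (int \<Rightarrow> nat \<Rightarrow> 'w \<Rightarrow> bool) \<Rightarrow> (int \<Rightarrow> 'w \<Rightarrow> real) \<Rightarrow> bool" where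
  "s6v_speed_process M \<chi>\<^sub>1 \<chi>\<^sub>2 U \<longleftrightarrow>
     (\<forall>x. U x \<in> borel_measurable M) \<and>
     (AE \<omega> in M. \<forall>x. U x \<omega> = s6v_speed (\<lambda>y t. \<chi>\<^sub>1 y t \<omega>) (\<lambda>y t. \<chi>\<^sub>2 y t \<omega>) x)"

definition translation :: "int \<Rightarrow> (int \<Rightarrow> 'a) \<Rightarrow> int \<Rightarrow> 'a" where
  "translation n f = (\<lambda>x. f (x + n))"

definition translation_invariant :: "(int \<Rightarrow> 'a) measure \<Rightarrow> bool" where
  "translation_invariant \<mu> \<longleftrightarrow>
     (\<forall>n. translation n \<in> \<mu> \<rightarrow>\<^sub>M \<mu> \<and> distr \<mu> \<mu> (translation n) = \<mu>)"

definition translation_ergodic :: "(int \<Rightarrow> 'a) measure \<Rightarrow> bool" where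
  "translation_ergodic \<mu> \<longleftrightarrow>
     prob_space \<mu> \<and> translation_invariant \<mu> \<and>
     (\<forall>A\<in>sets \<mu>. (\<forall>n. translation n -` A \<inter> space \<mu> = A) \<longrightarrow> measure \<mu> A = 0 \<or> measure \<mu> A = 1)"

end

theory Submission
  imports Defs
begin

text \<open>A vertex with \<open>\<chi>\<^sup>1 = \<chi>\<^sup>2 = 0\<close> cuts its row: what it sends to the right does not depend on what
  enters from the left. Almost surely every row has cuts arbitrarily far to the left, and then the
  assignment, the positions and the speeds are a measurable function of the environment, given
  explicitly by scanning from the nearest cut. Since translating the environment by \<open>n\<close> moves every
  particle by \<open>n\<close> and changes its class by \<open>n\<close>, which is invisible in \<open>X\<^sub>t / t\<close>, this function commutes
  with translations. So the speed process is a factor of an i.i.d. field, which is mixing under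
  translations. The limits defining the speeds need not exist for this: the limit operator sends all
  divergent sequences to one and the same value.\<close>

section \<open>Mixing of product measures\<close>

lemma measurable_reindex:
  assumes "\<And>i. p (s i) = p i"
  shows "(\<lambda>\<omega> i. \<omega> (s i)) \<in> Pi\<^sub>M UNIV p \<rightarrow>\<^sub>M Pi\<^sub>M UNIV p"
proof (rule measurable_PiM_single')
  fix i
  show "(\<lambda>\<omega>. \<omega> (s i)) \<in> Pi\<^sub>M UNIV p \<rightarrow>\<^sub>M p i"
    using measurable_component_singleton[of "s i" UNIV p] by (simp add: assms)
next
  have "\<omega> (s i) \<in> space (p i)" if "\<omega> \<in> space (Pi\<^sub>M UNIV p)" for \<omega> i
    using that PiE_mem[of \<omega> UNIV "\<lambda>i. space (p i)" "s i"] by (simp add: space_PiM assms)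
  then show "(\<lambda>\<omega> i. \<omega> (s i)) \<in> space (Pi\<^sub>M UNIV p) \<rightarrow> (\<Pi>\<^sub>E i\<in>UNIV. space (p i))"
    by auto
qed

lemma distr_PiM_reindex_UNIV:
  assumes "\<And>i. prob_space (p i)" "inj s" and inv: "\<And>i. p (s i) = p i"
  shows "distr (Pi\<^sub>M UNIV p) (Pi\<^sub>M UNIV p) (\<lambda>\<omega> i. \<omega> (s i)) = Pi\<^sub>M UNIV p"
  using distr_PiM_reindex[of UNIV p s UNIV] assms by (simp add: restrict_UNIV)

lemma prod_emb_PiE_UNIV:
  "prod_emb UNIV p J (Pi\<^sub>E J X) = {\<omega>\<in>space (Pi\<^sub>M UNIV p). \<forall>i\<in>J. \<omega> i \<in> X i}"
  by (auto simp: prod_emb_def space_PiM restrict_PiE_iff)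

lemma measure_PiM_Collect_UNIV:
  assumes "\<And>i. prob_space (p i)" "finite J" "\<And>i. i \<in> J \<Longrightarrow> X i \<in> sets (p i)"
  shows "measure (Pi\<^sub>M UNIV p) {\<omega>\<in>space (Pi\<^sub>M UNIV p). \<forall>i\<in>J. \<omega> i \<in> X i} = (\<Prod>i\<in>J. measure (p i) (X i))"
proof -
  interpret product_prob_space p UNIV
    using assms(1) by (simp add: product_prob_spaceI)
  have "measure (Pi\<^sub>M UNIV p) (prod_emb UNIV p J (Pi\<^sub>E J X)) = (\<Prod>i\<in>J. measure (p i) (X i))"
    by (rule measure_PiM_emb) (use assms in simp_all)
  then show ?thesis by (simp only: prod_emb_PiE_UNIV)
qed

text \<open>If \<open>C\<close> is a cylinder, then for large \<open>n\<close> the index map carries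
  its finitely many coordinates away from those of \<open>A\<close>, and independence gives the
  product exactly. The limit relation survives complements and countable disjoint unions in
  \<open>C\<close>, so it extends to the whole product sigma-algebra by the pi-lambda
  theorem.\<close>

lemma product_measure_mixing:
  fixes p :: "'i \<Rightarrow> 'a measure" and \<sigma> :: "nat \<Rightarrow> 'i \<Rightarrow> 'i"
  assumes prob: "\<And>i. prob_space (p i)" and inj: "\<And>n. inj (\<sigma> n)"
    and inv: "\<And>n i. p (\<sigma> n i) = p i" and escape: "\<And>i j. finite {n. \<sigma> n i = j}"
    and A: "A \<in> prod_algebra UNIV p" and C: "C \<in> sets (Pi\<^sub>M UNIV p)"
  shows "(\<lambda>n. measure (Pi\<^sub>M UNIV p) (A \<inter> ((\<lambda>\<omega> i. \<omega> (\<sigma> n i)) -` C \<inter> space (Pi\<^sub>M UNIV p))))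
    \<longlonglongrightarrow> measure (Pi\<^sub>M UNIV p) A * measure (Pi\<^sub>M UNIV p) C"
proof -
  let ?P = "Pi\<^sub>M UNIV p"
  interpret product_prob_space p UNIV
    using prob by (simp add: product_prob_spaceI)
  define S where "S n = (\<lambda>\<omega> i. \<omega> (\<sigma> n i) :: 'a)" for n
  have S[measurable]: "S n \<in> ?P \<rightarrow>\<^sub>M ?P" for n
    unfolding S_def using inv by (rule measurable_reindex)
  have S_preserves: "measure ?P (S n -` C \<inter> space ?P) = measure ?P C" if "C \<in> sets ?P" for n C
    using measure_distr[OF S that, of n] distr_PiM_reindex_UNIV[of p "\<sigma> n", OF prob inj inv]
    by (simp add: S_def)
  have Sp: "S n \<omega> \<in> space ?P" if "\<omega> \<in> space ?P" for n \<omega>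
    using measurable_space[OF S that] .
  have A_sets: "A \<in> sets ?P"
    using A by (auto simp: sets_PiM)
  note rect = measure_PiM_Collect_UNIV[of p, OF prob]
  have rect_form: "\<exists>J X. finite J \<and> (\<forall>i\<in>J. X i \<in> sets (p i)) \<and>
      D = {\<omega>\<in>space ?P. \<forall>i\<in>J. \<omega> i \<in> X i}" if "D \<in> prod_algebra UNIV p" for D
    using that
  proof (rule prod_algebraE)
    fix J X assume "D = prod_emb UNIV p J (Pi\<^sub>E J X)" "finite J" and
      X: "\<And>i. i \<in> J \<Longrightarrow> X i \<in> sets (p i)"
    then show ?thesis unfolding prod_emb_PiE_UNIV by blast
  qed
  obtain J X where J: "finite J" and X: "\<And>i. i \<in> J \<Longrightarrow> X i \<in> sets (p i)"
    and A_eq: "A = {\<omega>\<in>space ?P. \<forall>i\<in>J. \<omega> i \<in> X i}"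
    using rect_form[OF A] by blast
  have "C \<in> sigma_sets (\<Pi>\<^sub>E i\<in>UNIV. space (p i)) (prod_algebra UNIV p)"
    using C by (simp add: sets_PiM)
  with Int_stable_prod_algebra prod_algebra_sets_into_space
  have "(\<lambda>n. measure ?P (A \<inter> (S n -` C \<inter> space ?P))) \<longlonglongrightarrow> measure ?P A * measure ?P C"
  proof (induction rule: sigma_sets_induct_disjoint)
    case (basic C)
    obtain K Y where K: "finite K" and Y: "\<And>i. i \<in> K \<Longrightarrow> Y i \<in> sets (p i)"
      and C_eq: "C = {\<omega>\<in>space ?P. \<forall>i\<in>K. \<omega> i \<in> Y i}"
      using rect_form[OF basic] by blast
    \<comment> \<open>By \<open>escape\<close>, each pair of a coordinate of \<open>C\<close> and a
      coordinate of \<open>A\<close> spoils only finitely many \<open>n\<close>.\<close>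
    have "finite (\<Union>i\<in>K. \<Union>j\<in>J. {n. \<sigma> n i = j})"
      using K J escape by auto
    moreover have "{n. \<not> \<sigma> n ` K \<inter> J = {}} \<subseteq> (\<Union>i\<in>K. \<Union>j\<in>J. {n. \<sigma> n i = j})" by auto
    ultimately have "\<forall>\<^sub>F n in sequentially. \<sigma> n ` K \<inter> J = {}"
      unfolding cofinite_eq_sequentially[symmetric] eventually_cofinite by (rule finite_subset[rotated])
    moreover have "measure ?P (A \<inter> (S n -` C \<inter> space ?P)) = measure ?P A * measure ?P C"
      if disj: "\<sigma> n ` K \<inter> J = {}" for n
    proof -
      \<comment> \<open>\<open>Z\<close> merges the constraints of \<open>A\<close> and of the
        shifted \<open>C\<close> into one cylinder; injectivity of \<open>\<sigma> n\<close> lets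
        \<open>inv_into\<close> recover the coordinate of \<open>C\<close>.\<close>
      define Z where "Z i = (if i \<in> J then X i else Y (inv_into K (\<sigma> n) i))" for i
      have inj_K: "inj_on (\<sigma> n) K" using inj[of n] by (auto simp: inj_on_def)
      have Z_J: "Z i = X i" if "i \<in> J" for i using that by (simp add: Z_def)
      have Z_K: "Z (\<sigma> n i) = Y i" if "i \<in> K" for i
        using that disj inj_K by (auto simp: Z_def)
      have "A \<inter> (S n -` C \<inter> space ?P) = {\<omega>\<in>space ?P. \<forall>i\<in>J \<union> \<sigma> n ` K. \<omega> i \<in> Z i}"
        using Sp by (auto simp: A_eq C_eq S_def ball_Un Z_J Z_K)
      also have "measure ?P \<dots> = (\<Prod>i\<in>J \<union> \<sigma> n ` K. measure (p i) (Z i))"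
        using J K X Y inv by (intro rect) (auto simp: Z_J Z_K)
      also have "\<dots> = (\<Prod>i\<in>J. measure (p i) (Z i)) * (\<Prod>i\<in>\<sigma> n ` K. measure (p i) (Z i))"
        using J K disj by (intro prod.union_disjoint) auto
      also have "(\<Prod>i\<in>J. measure (p i) (Z i)) = measure ?P A"
        using J X by (simp add: A_eq rect Z_J)
      also have "(\<Prod>i\<in>\<sigma> n ` K. measure (p i) (Z i)) = measure ?P C"
        using K Y by (simp add: C_eq rect prod.reindex[OF inj_K] Z_K inv)
      finally show ?thesis .
    qed
    ultimately have "\<forall>\<^sub>F n in sequentially.
        measure ?P (A \<inter> (S n -` C \<inter> space ?P)) = measure ?P A * measure ?P C"
      by (auto elim: eventually_mono)
    then show ?case by (rule tendsto_eventually)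
  next
    case empty
    then show ?case by simp
  next
    case (compl C)
    then have C: "C \<in> sets ?P" by (simp add: sets_PiM)
    have "measure ?P (A \<inter> (S n -` ((\<Pi>\<^sub>E i\<in>UNIV. space (p i)) - C) \<inter> space ?P)) =
        measure ?P A - measure ?P (A \<inter> (S n -` C \<inter> space ?P))" for n
    proof -
      have "A \<inter> (S n -` ((\<Pi>\<^sub>E i\<in>UNIV. space (p i)) - C) \<inter> space ?P) = A - A \<inter> (S n -` C \<inter> space ?P)"
        using sets.sets_into_space[OF A_sets] Sp[of _ n] by (auto simp: space_PiM)
      then show ?thesis
        using A_sets C by (simp add: P.finite_measure_Diff)
    qed
    moreover have "measure ?P A * measure ?P ((\<Pi>\<^sub>E i\<in>UNIV. space (p i)) - C) =
        measure ?P A - measure ?P A * measure ?P C"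
      using P.prob_compl[OF C] by (simp only: space_PiM right_diff_distrib mult_1_right)
    ultimately show ?case
      using tendsto_diff[OF tendsto_const compl.IH, of "measure ?P A"] by simp
  next
    case (union C)
    then have C: "range C \<subseteq> sets ?P" by (simp add: sets_PiM)
    then have Ck: "C k \<in> sets ?P" for k by auto
    have sums_C: "(\<lambda>k. measure ?P (C k)) sums measure ?P (\<Union>k. C k)"
      using C union.hyps by (intro P.finite_measure_UNION) auto
    have sums_A: "(\<lambda>k. measure ?P (A \<inter> (S n -` C k \<inter> space ?P))) sums
        measure ?P (A \<inter> (S n -` (\<Union>k. C k) \<inter> space ?P))" for n
    proof -
      have "disjoint_family (\<lambda>k. A \<inter> (S n -` C k \<inter> space ?P))"
        using union.hyps by (fastforce simp: disjoint_family_on_def)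
      then have "(\<lambda>k. measure ?P (A \<inter> (S n -` C k \<inter> space ?P))) sums
          measure ?P (\<Union>k. A \<inter> (S n -` C k \<inter> space ?P))"
        using A_sets Ck by (intro P.finite_measure_UNION) auto
      also have "(\<Union>k. A \<inter> (S n -` C k \<inter> space ?P)) = A \<inter> (S n -` (\<Union>k. C k) \<inter> space ?P)"
        by auto
      finally show ?thesis .
    qed
    have "(\<lambda>n. \<Sum>k. measure ?P (A \<inter> (S n -` C k \<inter> space ?P))) \<longlonglongrightarrow>
        (\<Sum>k. measure ?P A * measure ?P (C k))"
    \<comment> \<open>Limit and sum are exchanged: since \<open>S n\<close> preserves the measure,
      \<open>measure ?P (C k)\<close> is a bound uniform in \<open>n\<close>, and it is summable by
      disjointness.\<close>
    proof (rule tannerys_theorem[THEN conjunct2, THEN conjunct2])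
      show "(\<lambda>n. measure ?P (A \<inter> (S n -` C k \<inter> space ?P))) \<longlonglongrightarrow> measure ?P A * measure ?P (C k)" for k
        by (rule union.IH)
      show "\<forall>\<^sub>F (k, n) in at_top \<times>\<^sub>F sequentially.
          norm (measure ?P (A \<inter> (S n -` C k \<inter> space ?P))) \<le> measure ?P (C k)"
      proof (intro always_eventually allI, clarify)
        fix k n
        have "measure ?P (A \<inter> (S n -` C k \<inter> space ?P)) \<le> measure ?P (S n -` C k \<inter> space ?P)"
          using Ck by (intro P.finite_measure_mono) auto
        then show "norm (measure ?P (A \<inter> (S n -` C k \<inter> space ?P))) \<le> measure ?P (C k)"
          using S_preserves[OF Ck] by simp
      qed
      show "summable (\<lambda>k. measure ?P (C k))"
        using sums_C by (rule sums_summable)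
    qed simp
    then show ?case
      using sums_mult[OF sums_C, of "measure ?P A"] sums_A by (simp add: sums_iff)
  qed
  then show ?thesis by (simp add: S_def)
qed

text \<open>For an invariant \<open>B\<close> the mixing sequence with \<open>C = B\<close> is
  constant, so \<open>B\<close> is independent of every cylinder, hence of the generated
  sigma-algebra and of itself: its measure solves \<open>m = m * m\<close>.\<close>

theorem product_measure_zero_one:
  fixes p :: "'i \<Rightarrow> 'a measure" and \<sigma> :: "nat \<Rightarrow> 'i \<Rightarrow> 'i"
  assumes prob: "\<And>i. prob_space (p i)" and inj: "\<And>n. inj (\<sigma> n)"
    and inv: "\<And>n i. p (\<sigma> n i) = p i" and escape: "\<And>i j. finite {n. \<sigma> n i = j}"
    and B: "B \<in> sets (Pi\<^sub>M UNIV p)"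
    and B_inv: "\<And>n. (\<lambda>\<omega> i. \<omega> (\<sigma> n i)) -` B \<inter> space (Pi\<^sub>M UNIV p) = B"
  shows "measure (Pi\<^sub>M UNIV p) B = 0 \<or> measure (Pi\<^sub>M UNIV p) B = 1"
proof -
  let ?P = "Pi\<^sub>M UNIV p"
  interpret product_prob_space p UNIV
    using prob by (simp add: product_prob_spaceI)
  have prod: "measure ?P (A \<inter> B) = measure ?P A * measure ?P B" if "A \<in> prod_algebra UNIV p" for A
    using product_measure_mixing[OF prob inj inv escape that B] unfolding B_inv
    by (simp add: LIMSEQ_const_iff)
  have sets: "sets ?P = sigma_sets (space ?P) (prod_algebra UNIV p)"
    by (simp add: sets_PiM space_PiM)
  have "P.indep_set (prod_algebra UNIV p) {B}"
    unfolding P.indep_sets2_eq using prod B by (auto simp: sets)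
  then have "P.indep_set (sigma_sets (space ?P) (prod_algebra UNIV p)) (sigma_sets (space ?P) {B})"
    by (rule P.indep_set_sigma_sets) (simp add: Int_stable_prod_algebra, simp add: Int_stable_def)
  then have "measure ?P (B \<inter> B) = measure ?P B * measure ?P B"
    by (rule P.indep_setD) (use B in \<open>auto simp: sets\<close>)
  then show ?thesis by simp
qed

section \<open>The assignment determined by the cuts\<close>

text \<open>Since \<open>x\<close> is arbitrary, one cut to the left of each \<open>x\<close>
  amounts to cuts arbitrarily far to the left. The distance \<open>k\<close> is counted from
  \<open>x - 1\<close>, so that \<open>LEAST\<close> finds the nearest cut.\<close>

definition infinite_left_cuts :: "(int \<Rightarrow> nat \<Rightarrow> bool) \<Rightarrow> (int \<Rightarrow> nat \<Rightarrow> bool) \<Rightarrow> bool" where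
  "infinite_left_cuts u v \<longleftrightarrow> (\<forall>t x. \<exists>k::nat. \<not> u (x - 1 - int k) t \<and> \<not> v (x - 1 - int k) t)"

text \<open>Meant for a cut at \<open>x - 1 - k\<close>. The base case is the class that a cut at
  \<open>x - 1\<close> sends to the right, namely its bottom class; the recursion then passes the
  \<open>k\<close> vertices between the cut and \<open>x\<close>.\<close>

primrec row_scan :: "(int \<Rightarrow> bool) \<Rightarrow> (int \<Rightarrow> bool) \<Rightarrow> (int \<Rightarrow> ereal) \<Rightarrow> nat \<Rightarrow> int \<Rightarrow> ereal" where
  "row_scan u v \<eta> 0 x = \<eta> (x - 1)"
| "row_scan u v \<eta> (Suc k) x =
     snd (vertex_out (u (x - 1)) (v (x - 1)) (\<eta> (x - 1)) (row_scan u v \<eta> k (x - 1)))"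

definition row_left :: "(int \<Rightarrow> bool) \<Rightarrow> (int \<Rightarrow> bool) \<Rightarrow> (int \<Rightarrow> ereal) \<Rightarrow> int \<Rightarrow> ereal" where
  "row_left u v \<eta> x = row_scan u v \<eta> (LEAST k. \<not> u (x - 1 - int k) \<and> \<not> v (x - 1 - int k)) x"

primrec s6v_rows ::
    "(int \<Rightarrow> nat \<Rightarrow> bool) \<Rightarrow> (int \<Rightarrow> nat \<Rightarrow> bool) \<Rightarrow> (int \<Rightarrow> ereal) \<Rightarrow> nat \<Rightarrow> int \<Rightarrow> ereal" where
  "s6v_rows u v \<eta>\<^sub>0 0 = \<eta>\<^sub>0"
| "s6v_rows u v \<eta>\<^sub>0 (Suc t) = (\<lambda>x. fst (vertex_out (u x t) (v x t) (s6v_rows u v \<eta>\<^sub>0 t x)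
     (row_left (\<lambda>y. u y t) (\<lambda>y. v y t) (s6v_rows u v \<eta>\<^sub>0 t) x)))"

lemma vertex_out_cut: "vertex_out False False a c = (c, a)"
  by (simp add: vertex_out_def)

lemma vertex_out_cases: "vertex_out u v a c = (a, c) \<or> vertex_out u v a c = (c, a)"
  by (simp add: vertex_out_def)

text \<open>If \<open>x\<close> is a cut, it is the nearest one to the left of \<open>x + 1\<close>
  and the scan has length 0. Otherwise \<open>x\<close> and \<open>x + 1\<close> share their nearest
  cut, and the scan grows by one vertex.\<close>

lemma row_left_step:
  assumes "\<exists>k::nat. \<not> u (x - 1 - int k) \<and> \<not> v (x - 1 - int k)"
  shows "row_left u v \<eta> (x + 1) = snd (vertex_out (u x) (v x) (\<eta> x) (row_left u v \<eta> x))"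
proof (cases "\<not> u x \<and> \<not> v x")
  case True
  then have "(LEAST k. \<not> u (x + 1 - 1 - int k) \<and> \<not> v (x + 1 - 1 - int k)) = 0"
    by (intro Least_eq_0) simp
  with True show ?thesis by (simp add: row_left_def vertex_out_cut)
next
  case False
  let ?Q = "\<lambda>k. \<not> u (x + 1 - 1 - int k) \<and> \<not> v (x + 1 - 1 - int k)"
  let ?P = "\<lambda>k. \<not> u (x - 1 - int k) \<and> \<not> v (x - 1 - int k)"
  have eq: "?Q (Suc k) = ?P k" for k
    by (simp add: algebra_simps)
  obtain k where "?P k" using assms by blast
  then have "?Q (Suc k)" using eq by blast
  then have "(LEAST k. ?Q k) = Suc (LEAST k. ?Q (Suc k))"
    by (rule Least_Suc) (use False in simp)
  then have "(LEAST k. ?Q k) = Suc (LEAST k. ?P k)"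
    unfolding eq .
  then show ?thesis by (simp add: row_left_def)
qed

text \<open>Any cut will do, near or far: the class it sends to the right is forced, and the rules
  propagate this value to \<open>x\<close>.\<close>

lemma row_scan_unique:
  assumes step: "\<And>x. \<kappa> (x + 1) = snd (vertex_out (u x) (v x) (\<eta> x) (\<kappa> x))"
    and "\<not> u (x - 1 - int k)" "\<not> v (x - 1 - int k)"
  shows "\<kappa> x = row_scan u v \<eta> k x"
  using assms(2,3)
proof (induction k arbitrary: x)
  case 0
  then show ?case using step[of "x - 1"] by (simp add: vertex_out_cut)
next
  case (Suc k)
  have "\<kappa> (x - 1) = row_scan u v \<eta> k (x - 1)"
    by (rule Suc.IH) (use Suc.prems in \<open>simp_all add: algebra_simps\<close>)
  then show ?case using step[of "x - 1"] by simp
qed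

lemma row_left_unique:
  assumes "\<And>x. \<kappa> (x + 1) = snd (vertex_out (u x) (v x) (\<eta> x) (\<kappa> x))"
    and "\<exists>k::nat. \<not> u (x - 1 - int k) \<and> \<not> v (x - 1 - int k)"
  shows "\<kappa> x = row_left u v \<eta> x"
  unfolding row_left_def
  using LeastI_ex[OF assms(2)] by (intro row_scan_unique assms(1)) auto

lemma s6v_assignment_rows:
  assumes "infinite_left_cuts u v"
  shows "s6v_assignment u v \<eta>\<^sub>0 (s6v_rows u v \<eta>\<^sub>0)
    (\<lambda>t. row_left (\<lambda>y. u y t) (\<lambda>y. v y t) (s6v_rows u v \<eta>\<^sub>0 t))"
proof -
  have "row_left (\<lambda>y. u y t) (\<lambda>y. v y t) \<eta> (x + 1) =
      snd (vertex_out (u x t) (v x t) (\<eta> x) (row_left (\<lambda>y. u y t) (\<lambda>y. v y t) \<eta> x))" for t x \<eta>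
    using assms unfolding infinite_left_cuts_def by (intro row_left_step) blast
  then show ?thesis by (simp add: s6v_assignment_def prod_eq_iff)
qed

text \<open>Induction on rows: the bottom classes of a row determine its left classes through the
  cuts, and both determine the next row. Together with existence this evaluates the definite
  description in \<open>s6v_config\<close>.\<close>

lemma s6v_assignment_unique:
  assumes cuts: "infinite_left_cuts u v" and asg: "s6v_assignment u v \<eta>\<^sub>0 \<eta> \<kappa>"
  shows "\<eta> = s6v_rows u v \<eta>\<^sub>0"
    and "\<kappa> = (\<lambda>t. row_left (\<lambda>y. u y t) (\<lambda>y. v y t) (s6v_rows u v \<eta>\<^sub>0 t))"
proof -
  have top: "\<eta> (Suc t) x = fst (vertex_out (u x t) (v x t) (\<eta> t x) (\<kappa> t x))"
    and right: "\<kappa> t (x + 1) = snd (vertex_out (u x t) (v x t) (\<eta> t x) (\<kappa> t x))" for t x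
    using asg unfolding s6v_assignment_def by (metis fst_conv, metis snd_conv)
  have left: "\<kappa> t x = row_left (\<lambda>y. u y t) (\<lambda>y. v y t) (\<eta> t) x" for t x
    by (rule row_left_unique) (use right cuts in \<open>auto simp: infinite_left_cuts_def\<close>)
  have "\<eta> t = s6v_rows u v \<eta>\<^sub>0 t" for t
  proof (induction t)
    case 0
    then show ?case using asg by (simp add: s6v_assignment_def)
  next
    case (Suc t)
    then show ?case by (auto simp: top left)
  qed
  then show eta: "\<eta> = s6v_rows u v \<eta>\<^sub>0" by auto
  show "\<kappa> = (\<lambda>t. row_left (\<lambda>y. u y t) (\<lambda>y. v y t) (s6v_rows u v \<eta>\<^sub>0 t))"
    by (intro ext) (simp add: left eta)
qed

lemma s6v_config_eq_rows:
  assumes "infinite_left_cuts u v"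
  shows "s6v_config u v \<eta>\<^sub>0 = s6v_rows u v \<eta>\<^sub>0"
proof -
  have "(THE (\<eta>, \<kappa>). s6v_assignment u v \<eta>\<^sub>0 \<eta> \<kappa>) = (s6v_rows u v \<eta>\<^sub>0,
    \<lambda>t. row_left (\<lambda>y. u y t) (\<lambda>y. v y t) (s6v_rows u v \<eta>\<^sub>0 t))"
    using s6v_assignment_rows[OF assms] s6v_assignment_unique[OF assms]
    by (intro the_equality) auto
  then show ?thesis by (simp add: s6v_config_def)
qed

section \<open>Injectivity of the configurations\<close>

text \<open>Sweep through the row from a cut \<open>y\<^sub>0\<close> on, listing the outgoing classes behind the current
  vertex, then the class carried to the right, then the remaining incoming classes. Each vertex
  either leaves this list unchanged or swaps two neighbouring entries.\<close>

lemma row_update_inj: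
  assumes inj: "inj \<eta>"
    and \<eta>': "\<And>x. \<eta>' x = fst (vertex_out (u x) (v x) (\<eta> x) (\<kappa> x))"
    and \<kappa>: "\<And>x. \<kappa> (x + 1) = snd (vertex_out (u x) (v x) (\<eta> x) (\<kappa> x))"
    and cuts: "\<And>x. \<exists>k::nat. \<not> u (x - 1 - int k) \<and> \<not> v (x - 1 - int k)"
  shows "inj \<eta>'"
proof (rule injI)
  fix a b :: int
  assume eq: "\<eta>' a = \<eta>' b"
  obtain k where k: "\<not> u (min a b - 1 - int k)" "\<not> v (min a b - 1 - int k)"
    using cuts by blast
  \<comment> \<open>This is a cut to the left of both \<open>a\<close> and \<open>b\<close>, so it
    carries \<open>\<eta> y\<^sub>0\<close> to the right, and the list starts out as
    \<open>\<eta>\<close> on \<open>{y\<^sub>0..}\<close>.\<close>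
  define y\<^sub>0 where "y\<^sub>0 = min a b - 1 - int k"
  \<comment> \<open>When the sweep stands before \<open>x\<close>, the carried class sits at
    \<open>x - 1\<close>, so the outgoing class of a vertex \<open>z\<close> is stored at
    \<open>z - 1\<close>. The outgoing class of \<open>y\<^sub>0\<close> itself is left out, as it
    comes from beyond the cut.\<close>
  define g where "g x y = (if y < x - 1 then \<eta>' (y + 1) else if y = x - 1 then \<kappa> x else \<eta> y)"
    for x y
  have "inj_on (g (y\<^sub>0 + 1 + int n)) {y\<^sub>0..}" for n
  proof (induction n)
    case 0
    have "\<kappa> (y\<^sub>0 + 1) = \<eta> y\<^sub>0"
      using \<kappa>[of y\<^sub>0] k by (simp add: y\<^sub>0_def vertex_out_cut)
    then have "g (y\<^sub>0 + 1 + int 0) y = \<eta> y" if "y \<in> {y\<^sub>0..}" for y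
      using that by (auto simp: g_def)
    then show ?case using inj by (auto simp: inj_on_def inj_def)
  next
    case (Suc n)
    define x where "x = y\<^sub>0 + 1 + int n"
    have IH: "inj_on (g x) {y\<^sub>0..}" using Suc by (simp add: x_def)
    have x: "y\<^sub>0 + 1 + int (Suc n) = x + 1" by (simp add: x_def)
    \<comment> \<open>If the vertex \<open>x\<close> exchanges its two classes, the list stays the
      same; if both go straight, the entries at \<open>x - 1\<close> and \<open>x\<close> are
      swapped.\<close>
    have "g (x + 1) = g x \<or> g (x + 1) = g x \<circ> Transposition.transpose (x - 1) x"
      using vertex_out_cases[of "u x" "v x" "\<eta> x" "\<kappa> x"]
      by (auto simp: g_def fun_eq_iff Transposition.transpose_def \<eta>' \<kappa>[of x])
    moreover have "Transposition.transpose (x - 1) x ` {y\<^sub>0..} \<subseteq> {y\<^sub>0..}"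
      by (auto simp: Transposition.transpose_def x_def)
    then have "inj_on (g x \<circ> Transposition.transpose (x - 1) x) {y\<^sub>0..}"
      by (intro comp_inj_on inj_on_subset[OF IH] inj_on_subset[OF inj_transpose]) auto
    ultimately show ?case using IH unfolding x by metis
  qed
  moreover have "y\<^sub>0 + 1 + int (nat (max a b - y\<^sub>0)) = max a b + 1"
    by (simp add: y\<^sub>0_def)
  ultimately have inj: "inj_on (g (max a b + 1)) {y\<^sub>0..}"
    by metis
  have "g (max a b + 1) (a - 1) = \<eta>' a" "g (max a b + 1) (b - 1) = \<eta>' b"
    by (auto simp: g_def)
  with eq inj have "a - 1 = b - 1"
    by (intro inj_onD[OF inj]) (auto simp: y\<^sub>0_def)
  then show "a = b" by simp
qed

text \<open>Gives uniqueness in the definite description of a position, both for its behaviour under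
  translations and for its measurability.\<close>

lemma inj_s6v_rows:
  assumes "infinite_left_cuts u v" "inj \<eta>\<^sub>0"
  shows "inj (s6v_rows u v \<eta>\<^sub>0 t)"
proof (induction t)
  case 0
  then show ?case using assms by simp
next
  case (Suc t)
  let ?\<kappa> = "row_left (\<lambda>y. u y t) (\<lambda>y. v y t) (s6v_rows u v \<eta>\<^sub>0 t)"
  have cuts: "\<exists>k::nat. \<not> u (x - 1 - int k) t \<and> \<not> v (x - 1 - int k) t" for x
    using assms(1) by (simp add: infinite_left_cuts_def)
  show ?case
    by (rule row_update_inj[OF Suc, of _ "\<lambda>y. u y t" "\<lambda>y. v y t" ?\<kappa>])
      (simp_all add: cuts row_left_step)
qed

lemma inj_packed: "inj packed"
  by (auto simp: inj_def packed_def)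

section \<open>Equivariance under translations\<close>

lemma infinite_left_cuts_shift:
  "infinite_left_cuts (\<lambda>x t. u (x + n) t) (\<lambda>x t. v (x + n) t) \<longleftrightarrow> infinite_left_cuts u v"
proof
  assume L: "infinite_left_cuts (\<lambda>x t. u (x + n) t) (\<lambda>x t. v (x + n) t)"
  show "infinite_left_cuts u v"
    unfolding infinite_left_cuts_def
  proof (intro allI)
    fix t x
    obtain k where "\<not> u (x - n - 1 - int k + n) t" "\<not> v (x - n - 1 - int k + n) t"
      using L[unfolded infinite_left_cuts_def, rule_format, of "x - n" t] by blast
    then show "\<exists>k. \<not> u (x - 1 - int k) t \<and> \<not> v (x - 1 - int k) t"
      by (intro exI[of _ k]) (simp add: algebra_simps)
  qed
next
  assume R: "infinite_left_cuts u v"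
  show "infinite_left_cuts (\<lambda>x t. u (x + n) t) (\<lambda>x t. v (x + n) t)"
    unfolding infinite_left_cuts_def
  proof (intro allI)
    fix t x
    obtain k where "\<not> u (x + n - 1 - int k) t" "\<not> v (x + n - 1 - int k) t"
      using R[unfolded infinite_left_cuts_def, rule_format, of "x + n" t] by blast
    then show "\<exists>k. \<not> u (x - 1 - int k + n) t \<and> \<not> v (x - 1 - int k + n) t"
      by (intro exI[of _ k]) (simp add: algebra_simps)
  qed
qed

text \<open>A vertex only compares its classes, and subtracting a finite real preserves equality and
  order, for infinite classes as well.\<close>

lemma vertex_out_diff_real:
  "vertex_out u v (a - ereal r) (c - ereal r) =
     (fst (vertex_out u v a c) - ereal r, snd (vertex_out u v a c) - ereal r)"
proof -
  have "a - ereal r = c - ereal r \<longleftrightarrow> a = c" "a - ereal r < c - ereal r \<longleftrightarrow> a < c"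
    by (cases a; cases c; simp)+
  then show ?thesis by (simp add: vertex_out_def)
qed

text \<open>Translating the assignment by \<open>n\<close> and lowering all classes by
  \<open>n\<close> restores the packed initial state and obeys the rules of the translated
  environment, so uniqueness identifies it.\<close>

lemma s6v_rows_shift:
  assumes "infinite_left_cuts u v"
  shows "s6v_rows (\<lambda>x t. u (x + n) t) (\<lambda>x t. v (x + n) t) packed t x =
    s6v_rows u v packed t (x + n) - ereal (real_of_int n)"
proof -
  let ?\<kappa> = "\<lambda>t. row_left (\<lambda>y. u y t) (\<lambda>y. v y t) (s6v_rows u v packed t)"
  have asg: "s6v_assignment u v packed (s6v_rows u v packed) ?\<kappa>"
    by (rule s6v_assignment_rows[OF assms])
  then have step: "?\<kappa> t (x + 1) =
      snd (vertex_out (u x t) (v x t) (s6v_rows u v packed t x) (?\<kappa> t x))" for t x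
    unfolding s6v_assignment_def by (metis snd_conv)
  have "s6v_assignment (\<lambda>x t. u (x + n) t) (\<lambda>x t. v (x + n) t) packed
      (\<lambda>t x. s6v_rows u v packed t (x + n) - ereal (real_of_int n))
      (\<lambda>t x. ?\<kappa> t (x + n) - ereal (real_of_int n))"
    unfolding s6v_assignment_def vertex_out_diff_real
    using step[of _ "_ + n"]
    by (auto simp: packed_def fun_eq_iff algebra_simps)
  then have "(\<lambda>t x. s6v_rows u v packed t (x + n) - ereal (real_of_int n)) =
      s6v_rows (\<lambda>x t. u (x + n) t) (\<lambda>x t. v (x + n) t) packed"
    by (rule s6v_assignment_unique(1)[rotated]) (simp add: infinite_left_cuts_shift assms)
  then show ?thesis by (metis (no_types, lifting))
qed

lemma s6v_position_eq_rows:
  assumes "infinite_left_cuts u v"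
  shows "s6v_position u v t x = (THE y. s6v_rows u v packed t y = packed x)"
  by (simp add: s6v_position_def s6v_config_eq_rows[OF assms])

text \<open>If no edge has class \<open>x\<close>, both descriptions denote the same unspecified integer, so existence
  of the particle is not needed for the following bound.\<close>

lemma s6v_position_shift:
  assumes "infinite_left_cuts u v"
  shows "\<bar>s6v_position (\<lambda>x t. u (x + n) t) (\<lambda>x t. v (x + n) t) t x - s6v_position u v t (x + n)\<bar> \<le> \<bar>n\<bar>"
proof -
  let ?P = "\<lambda>y. s6v_rows u v packed t y = packed (x + n)"
  have "(s6v_rows (\<lambda>x t. u (x + n) t) (\<lambda>x t. v (x + n) t) packed t y = packed x) = ?P (y + n)" for y
    unfolding s6v_rows_shift[OF assms]
    by (cases "s6v_rows u v packed t (y + n)") (auto simp: packed_def)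
  then have shifted: "s6v_position (\<lambda>x t. u (x + n) t) (\<lambda>x t. v (x + n) t) t x = (THE y. ?P (y + n))"
    by (simp add: s6v_position_eq_rows infinite_left_cuts_shift assms)
  have base: "s6v_position u v t (x + n) = (THE y. ?P y)"
    by (rule s6v_position_eq_rows[OF assms])
  have uniq: "y = z" if "?P y" "?P z" for y z
    using that inj_s6v_rows[OF assms inj_packed, of t] by (metis injD)
  show ?thesis
  proof (cases "\<exists>y. ?P y")
    case True
    then obtain y where y: "?P y" by blast
    have "(THE y. ?P y) = y"
      using y uniq by (intro the_equality) auto
    moreover have "(THE y. ?P (y + n)) = y - n"
    proof (rule the_equality)
      show "?P (y - n + n)" using y by simp
      show "z = y - n" if "?P (z + n)" for z
        using uniq[OF that y] by simp
    qed
    ultimately show ?thesis by (simp add: shifted base)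
  next
    case False
    then have "?P = (\<lambda>_. False)" "(\<lambda>y. ?P (y + n)) = (\<lambda>_. False)" by auto
    then show ?thesis by (simp only: shifted base)
  qed
qed

text \<open>\<open>lim\<close> is the definite description of a limit, so sequences with the same
  set of limits have the same \<open>lim\<close>, even when this set is empty.\<close>

lemma lim_eq_if_diff_tendsto_0:
  fixes f g :: "nat \<Rightarrow> 'a::real_normed_vector"
  assumes "(\<lambda>n. f n - g n) \<longlonglongrightarrow> 0"
  shows "lim f = lim g"
proof -
  have "f \<longlonglongrightarrow> L \<longleftrightarrow> g \<longlonglongrightarrow> L" for L
    using Lim_transform[OF _ assms] Lim_transform2[OF _ assms] by blast
  then show ?thesis by (simp add: lim_def)
qed

lemma s6v_speed_shift:
  assumes "infinite_left_cuts u v"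
  shows "s6v_speed (\<lambda>x t. u (x + n) t) (\<lambda>x t. v (x + n) t) x = s6v_speed u v (x + n)"
  unfolding s6v_speed_def
proof (rule lim_eq_if_diff_tendsto_0)
  let ?X = "s6v_position (\<lambda>x t. u (x + n) t) (\<lambda>x t. v (x + n) t)"
  let ?Y = "s6v_position u v"
  show "(\<lambda>t. real_of_int (?X t x) / real t - real_of_int (?Y t (x + n)) / real t) \<longlonglongrightarrow> 0"
  proof (rule Lim_null_comparison)
    show "\<forall>\<^sub>F t in sequentially. norm (real_of_int (?X t x) / real t - real_of_int (?Y t (x + n)) / real t)
        \<le> \<bar>real_of_int n\<bar> / real t"
    \<comment> \<open>At \<open>t = 0\<close> both quotients and the bound are 0 by the convention
      for division, so the bound holds for all \<open>t\<close>.\<close>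
    proof (intro always_eventually allI)
      fix t
      have "\<bar>real_of_int (?X t x) - real_of_int (?Y t (x + n))\<bar> \<le> \<bar>real_of_int n\<bar>"
        using s6v_position_shift[OF assms, of n t x] by linarith
      then show "norm (real_of_int (?X t x) / real t - real_of_int (?Y t (x + n)) / real t)
        \<le> \<bar>real_of_int n\<bar> / real t"
        by (simp add: diff_divide_distrib[symmetric] divide_right_mono)
    qed
    show "(\<lambda>t. \<bar>real_of_int n\<bar> / real t) \<longlonglongrightarrow> 0"
      by (rule lim_const_over_n)
  qed
qed

section \<open>The speeds as a factor of the environment\<close>

lemma measurable_vertex_out:
  assumes [measurable]: "Measurable.pred N u" "Measurable.pred N v"
    "a \<in> borel_measurable N" "c \<in> borel_measurable N"
  shows "(\<lambda>\<omega>. fst (vertex_out (u \<omega>) (v \<omega>) (a \<omega>) (c \<omega>))) \<in> borel_measurable N"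
    and "(\<lambda>\<omega>. snd (vertex_out (u \<omega>) (v \<omega>) (a \<omega>) (c \<omega>))) \<in> borel_measurable N"
  by (simp_all add: vertex_out_def if_distrib[of fst] if_distrib[of snd])

lemma measurable_row_left:
  assumes u[measurable]: "\<And>x. Measurable.pred N (\<lambda>\<omega>. u \<omega> x)"
    and v[measurable]: "\<And>x. Measurable.pred N (\<lambda>\<omega>. v \<omega> x)"
    and \<eta>: "\<And>x. (\<lambda>\<omega>. \<eta> \<omega> x) \<in> borel_measurable N"
  shows "(\<lambda>\<omega>. row_left (u \<omega>) (v \<omega>) (\<eta> \<omega>) x) \<in> borel_measurable N"
proof -
  have "(\<lambda>\<omega>. row_scan (u \<omega>) (v \<omega>) (\<eta> \<omega>) k x) \<in> borel_measurable N" for k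
  proof (induction k arbitrary: x)
    case 0
    then show ?case using \<eta> by simp
  next
    case (Suc k)
    show ?case unfolding row_scan.simps by (rule measurable_vertex_out(2)[OF u v \<eta> Suc])
  qed
  \<comment> \<open>The scan length is random but takes countably many values, so it can be
    fixed.\<close>
  then show ?thesis
    unfolding row_left_def by (rule measurable_compose_countable) simp
qed

lemma measurable_s6v_rows:
  assumes u: "\<And>x t. Measurable.pred N (\<lambda>\<omega>. u \<omega> x t)"
    and v: "\<And>x t. Measurable.pred N (\<lambda>\<omega>. v \<omega> x t)"
  shows "(\<lambda>\<omega>. s6v_rows (u \<omega>) (v \<omega>) \<eta>\<^sub>0 t x) \<in> borel_measurable N"
proof (induction t arbitrary: x)
  case 0
  then show ?case by simp
next
  case (Suc t)
  show ?case
    unfolding s6v_rows.simps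
    by (intro measurable_vertex_out(1) measurable_row_left u v Suc)
qed

lemma measurable_infinite_left_cuts:
  assumes [measurable]: "\<And>x t. Measurable.pred N (\<lambda>\<omega>. u \<omega> x t)"
    "\<And>x t. Measurable.pred N (\<lambda>\<omega>. v \<omega> x t)"
  shows "Measurable.pred N (\<lambda>\<omega>. infinite_left_cuts (u \<omega>) (v \<omega>))"
  unfolding infinite_left_cuts_def by measurable

text \<open>With the value 0 off the translation-invariant cut event, this is measurable and
  commutes with translations for every environment.\<close>

definition cut_speed :: "(int \<Rightarrow> nat \<Rightarrow> bool) \<Rightarrow> (int \<Rightarrow> nat \<Rightarrow> bool) \<Rightarrow> int \<Rightarrow> real" where
  "cut_speed u v x = (if infinite_left_cuts u v then s6v_speed u v x else 0)"

lemma measurable_cut_speed: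
  assumes u: "\<And>x t. Measurable.pred N (\<lambda>\<omega>. u \<omega> x t)"
    and v: "\<And>x t. Measurable.pred N (\<lambda>\<omega>. v \<omega> x t)"
  shows "(\<lambda>\<omega>. cut_speed (u \<omega>) (v \<omega>) x) \<in> borel_measurable N"
proof -
  note [measurable] = measurable_infinite_left_cuts[where u = u and v = v, OF u v]
    and [measurable] = measurable_s6v_rows[where u = u and v = v, OF u v]
  \<comment> \<open>The conjunct on cuts inside the description ensures that at most one
    \<open>y\<close> qualifies for every \<open>\<omega>\<close>, as \<open>measurable_THE\<close>
    requires.\<close>
  define X where "X t \<omega> =
    (THE y. infinite_left_cuts (u \<omega>) (v \<omega>) \<and> s6v_rows (u \<omega>) (v \<omega>) packed t y = packed x)" for t \<omega>
  have X[measurable]: "X t \<in> N \<rightarrow>\<^sub>M count_space UNIV" for t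
    unfolding X_def
  proof (rule measurable_THE[where I = UNIV])
    show "Measurable.pred N (\<lambda>\<omega>. infinite_left_cuts (u \<omega>) (v \<omega>) \<and>
        s6v_rows (u \<omega>) (v \<omega>) packed t y = packed x)" for y
      by measurable
    show "y = z" if "infinite_left_cuts (u \<omega>) (v \<omega>) \<and> s6v_rows (u \<omega>) (v \<omega>) packed t y = packed x"
      "infinite_left_cuts (u \<omega>) (v \<omega>) \<and> s6v_rows (u \<omega>) (v \<omega>) packed t z = packed x" for \<omega> y z
      using that inj_s6v_rows[OF _ inj_packed, of "u \<omega>" "v \<omega>" t] by (metis injD)
  qed simp_all
  have "cut_speed (u \<omega>) (v \<omega>) x = (if infinite_left_cuts (u \<omega>) (v \<omega>)
      then lim (\<lambda>t. real_of_int (X t \<omega>) / real t) else 0)" for \<omega>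
    by (simp add: cut_speed_def s6v_speed_def X_def s6v_position_eq_rows)
  then show ?thesis by simp
qed

lemma cut_speed_shift:
  "cut_speed (\<lambda>x t. u (x + n) t) (\<lambda>x t. v (x + n) t) x = cut_speed u v (x + n)"
  by (simp add: cut_speed_def infinite_left_cuts_shift s6v_speed_shift)

section \<open>The i.i.d. environment and its translations\<close>

text \<open>The two Bernoulli families form a single product space over \<open>(\<int> \<times> \<nat>) + (\<int> \<times> \<nat>)\<close>, with the
  first family on the left summand.\<close>

type_synonym site = "(int \<times> nat) + (int \<times> nat)"

definition site_shift :: "int \<Rightarrow> site \<Rightarrow> site" where
  "site_shift n = map_sum (\<lambda>(x, t). (x + n, t)) (\<lambda>(x, t). (x + n, t))"

definition site_law :: "real \<Rightarrow> real \<Rightarrow> site \<Rightarrow> bool measure" where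
  "site_law b\<^sub>1 b\<^sub>2 i = measure_pmf (bernoulli_pmf (case i of Inl _ \<Rightarrow> b\<^sub>1 | Inr _ \<Rightarrow> b\<^sub>2))"

definition env_measure :: "real \<Rightarrow> real \<Rightarrow> (site \<Rightarrow> bool) measure" where
  "env_measure b\<^sub>1 b\<^sub>2 = Pi\<^sub>M UNIV (site_law b\<^sub>1 b\<^sub>2)"

definition env_shift :: "int \<Rightarrow> (site \<Rightarrow> bool) \<Rightarrow> site \<Rightarrow> bool" where
  "env_shift n e = (\<lambda>i. e (site_shift n i))"

definition env_speed :: "(site \<Rightarrow> bool) \<Rightarrow> int \<Rightarrow> real" where
  "env_speed e = cut_speed (\<lambda>x t. e (Inl (x, t))) (\<lambda>x t. e (Inr (x, t)))"

lemma site_shift_simps [simp]: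
  "site_shift n (Inl (x, t)) = Inl (x + n, t)" "site_shift n (Inr (x, t)) = Inr (x + n, t)"
  by (simp_all add: site_shift_def)

lemma inj_site_shift: "inj (site_shift n)"
  unfolding site_shift_def by (rule sum.inj_map) (auto simp: inj_def)

lemma site_law_shift: "site_law b\<^sub>1 b\<^sub>2 (site_shift n i) = site_law b\<^sub>1 b\<^sub>2 i"
  by (cases i) (auto simp: site_law_def site_shift_def)

lemma site_shift_escape: "finite {n::nat. site_shift (int n) i = j}"
proof (rule finite_subset)
  \<comment> \<open>The first coordinates of \<open>i\<close> and \<open>j\<close> reveal
    \<open>n\<close>; \<open>case_sum id id\<close> forgets the summand.\<close>
  show "{n::nat. site_shift (int n) i = j} \<subseteq>
    {nat (fst (case_sum id id j) - fst (case_sum id id i))}"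
    by (cases i; cases j) (auto simp: site_shift_def)
qed simp

lemma prob_space_site_law: "prob_space (site_law b\<^sub>1 b\<^sub>2 i)"
  by (simp add: site_law_def prob_space_measure_pmf)

lemma prob_space_env_measure: "prob_space (env_measure b\<^sub>1 b\<^sub>2)"
  unfolding env_measure_def by (rule prob_space_PiM) (rule prob_space_site_law)

lemma space_env_measure [simp]: "space (env_measure b\<^sub>1 b\<^sub>2) = UNIV"
  by (simp add: env_measure_def site_law_def space_PiM PiE_UNIV_domain)

lemma measurable_env_coordinate [measurable]: "Measurable.pred (env_measure b\<^sub>1 b\<^sub>2) (\<lambda>e. e i)"
proof -
  have "(\<lambda>e. e i) \<in> env_measure b\<^sub>1 b\<^sub>2 \<rightarrow>\<^sub>M site_law b\<^sub>1 b\<^sub>2 i"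
    unfolding env_measure_def by (rule measurable_component_singleton) simp
  moreover have "sets (site_law b\<^sub>1 b\<^sub>2 i) = sets (count_space UNIV)"
    by (simp add: site_law_def)
  ultimately show ?thesis using measurable_cong_sets by blast
qed

lemma measurable_env_shift [measurable]: "env_shift n \<in> env_measure b\<^sub>1 b\<^sub>2 \<rightarrow>\<^sub>M env_measure b\<^sub>1 b\<^sub>2"
  unfolding env_shift_def env_measure_def by (rule measurable_reindex) (rule site_law_shift)

lemma distr_env_shift: "distr (env_measure b\<^sub>1 b\<^sub>2) (env_measure b\<^sub>1 b\<^sub>2) (env_shift n) = env_measure b\<^sub>1 b\<^sub>2"
  unfolding env_shift_def env_measure_def
  by (intro distr_PiM_reindex_UNIV prob_space_site_law inj_site_shift site_law_shift)

text \<open>Used twice: to see that a row almost surely has a cut, and for the ergodicity of the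
  speeds.\<close>

lemma env_shift_zero_one:
  assumes "B \<in> sets (env_measure b\<^sub>1 b\<^sub>2)" "\<And>n. env_shift (int n) -` B = B"
  shows "measure (env_measure b\<^sub>1 b\<^sub>2) B = 0 \<or> measure (env_measure b\<^sub>1 b\<^sub>2) B = 1"
  unfolding env_measure_def
proof (rule product_measure_zero_one[where \<sigma> = "\<lambda>n. site_shift (int n)"])
  show "B \<in> sets (Pi\<^sub>M UNIV (site_law b\<^sub>1 b\<^sub>2))"
    using assms(1) by (simp add: env_measure_def)
  show "(\<lambda>\<omega> i. \<omega> (site_shift (int n) i)) -` B \<inter> space (Pi\<^sub>M UNIV (site_law b\<^sub>1 b\<^sub>2)) = B" for n
    using assms(2)[of n] space_env_measure[of b\<^sub>1 b\<^sub>2] by (simp add: env_shift_def[abs_def] env_measure_def)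
qed (simp_all add: prob_space_site_law inj_site_shift site_law_shift site_shift_escape)

lemma measurable_env_speed [measurable]:
  "env_speed \<in> env_measure b\<^sub>1 b\<^sub>2 \<rightarrow>\<^sub>M Pi\<^sub>M UNIV (\<lambda>_. borel)"
proof (rule measurable_PiM_single')
  show "(\<lambda>e. env_speed e x) \<in> borel_measurable (env_measure b\<^sub>1 b\<^sub>2)" for x
    unfolding env_speed_def by (rule measurable_cut_speed) simp_all
qed simp

lemma env_speed_shift: "env_speed (env_shift n e) = translation n (env_speed e)"
  using cut_speed_shift[of "\<lambda>x t. e (Inl (x, t))" n "\<lambda>x t. e (Inr (x, t))"]
  by (simp add: env_speed_def env_shift_def translation_def fun_eq_iff)

text \<open>The events that the row \<open>t\<close> has no cut to the left of \<open>x\<close> all have the same probability and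
  decrease to the shift-invariant event that the row has no cut at all.\<close>

lemma AE_infinite_left_cuts:
  assumes b: "0 \<le> b\<^sub>1" "b\<^sub>1 < 1" "0 \<le> b\<^sub>2" "b\<^sub>2 < 1"
  shows "AE e in env_measure b\<^sub>1 b\<^sub>2. infinite_left_cuts (\<lambda>x t. e (Inl (x, t))) (\<lambda>x t. e (Inr (x, t)))"
proof -
  let ?E = "env_measure b\<^sub>1 b\<^sub>2"
  interpret prob_space ?E by (rule prob_space_env_measure)
  define A where "A t x = {e::site \<Rightarrow> bool. \<forall>y<x. e (Inl (y, t)) \<or> e (Inr (y, t))}" for t x
  define B where "B t = {e::site \<Rightarrow> bool. \<forall>y. e (Inl (y, t)) \<or> e (Inr (y, t))}" for t
  have A[measurable]: "A t x \<in> sets ?E" for t x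
  proof -
    have "{e\<in>space ?E. \<forall>y. y < x \<longrightarrow> e (Inl (y, t)) \<or> e (Inr (y, t))} \<in> sets ?E"
      by measurable
    then show ?thesis by (simp add: A_def)
  qed
  have B[measurable]: "B t \<in> sets ?E" for t
  proof -
    have "{e\<in>space ?E. \<forall>y. e (Inl (y, t)) \<or> e (Inr (y, t))} \<in> sets ?E"
      by measurable
    then show ?thesis by (simp add: B_def)
  qed
  have shift_A: "env_shift n -` A t x = A t (x + n)" for n t x
  proof (intro set_eqI iffI)
    fix e assume e: "e \<in> env_shift n -` A t x"
    show "e \<in> A t (x + n)"
      unfolding A_def
    proof (intro CollectI allI impI)
      fix y assume "y < x + n"
      then have "y - n < x" by simp
      with e show "e (Inl (y, t)) \<or> e (Inr (y, t))"
        unfolding A_def env_shift_def by force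
    qed
  qed (auto simp: A_def env_shift_def)
  have prob_A: "prob (A t x) = prob (A t 0)" for t x
    using measure_distr[OF measurable_env_shift[of x b\<^sub>1 b\<^sub>2] A[of t 0]] distr_env_shift[of b\<^sub>1 b\<^sub>2 x]
    by (simp add: shift_A)
  have A_antimono: "A t x \<subseteq> A t y" if "y \<le> x" for t x y
    using that by (force simp: A_def)
  have prob_A_B: "prob (A t x) = prob (B t)" for t x
  proof -
    \<comment> \<open>The limit is taken to the right: a larger \<open>x\<close> constrains more
      vertices, and in the limit the whole row.\<close>
    have "(\<lambda>n. prob (A t (int n))) \<longlonglongrightarrow> prob (\<Inter>n. A t (int n))"
      by (rule finite_Lim_measure_decseq)
        (use A A_antimono in \<open>simp_all add: decseq_def image_subset_iff\<close>)
    also have "(\<lambda>n. prob (A t (int n))) = (\<lambda>n. prob (A t x))"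
      using prob_A[of t] by metis
    also have "(\<Inter>n. A t (int n)) = B t"
    proof -
      have "\<exists>n. y < int n" for y :: int by (rule exI[of _ "Suc (nat y)"]) linarith
      then show ?thesis by (fastforce simp: A_def B_def)
    qed
    finally show ?thesis by (simp add: LIMSEQ_const_iff)
  qed
  have "env_shift n -` B t = B t" for n t
  proof (intro set_eqI iffI)
    fix e assume e: "e \<in> env_shift n -` B t"
    have "e (Inl (y, t)) \<or> e (Inr (y, t))" for y
      using e[unfolded B_def env_shift_def, simplified, rule_format, of "y - n"] by simp
    then show "e \<in> B t" by (simp add: B_def)
  qed (auto simp: B_def env_shift_def)
  then have "prob (B t) = 0 \<or> prob (B t) = 1" for t
    using B by (intro env_shift_zero_one) auto
  \<comment> \<open>A cut at the single vertex \<open>(0, t)\<close> has positive probability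
    \<open>(1 - b\<^sub>1) * (1 - b\<^sub>2)\<close>, which rules out the value 1.\<close>
  moreover have "prob (B t) < 1" for t
  proof -
    define R where "R = {e\<in>space ?E. \<forall>i\<in>{Inl (0, t), Inr (0, t)}. e i \<in> {False}}"
    have "prob R = (1 - b\<^sub>1) * (1 - b\<^sub>2)"
      unfolding R_def env_measure_def using b
      by (subst measure_PiM_Collect_UNIV)
        (auto simp: prob_space_measure_pmf site_law_def measure_pmf_single)
    then have "0 < prob R" using b by simp
    moreover have "R \<in> sets ?E" unfolding R_def by measurable
    moreover have "prob (B t) \<le> prob (space ?E - R)"
      using sets.compl_sets[OF \<open>R \<in> sets ?E\<close>] by (intro finite_measure_mono) (auto simp: B_def R_def)
    ultimately show ?thesis using prob_compl[of R] by simp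
  qed
  ultimately have "prob (A t x) = 0" for t x
    unfolding prob_A_B by (metis less_irrefl)
  then have "AE e in ?E. e \<notin> A t x" for t x
    by (intro AE_not_in) (auto simp: null_sets_def emeasure_eq_measure)
  then have "AE e in ?E. \<forall>t x. e \<notin> A t x" by (simp add: AE_all_countable)
  then show ?thesis
  proof (rule AE_mp, intro AE_I2 impI)
    fix e assume e: "\<forall>t x. e \<notin> A t x"
    show "infinite_left_cuts (\<lambda>x t. e (Inl (x, t))) (\<lambda>x t. e (Inr (x, t)))"
      unfolding infinite_left_cuts_def
    proof (intro allI)
      fix t x
      obtain y where y: "y < x" "\<not> e (Inl (y, t))" "\<not> e (Inr (y, t))"
        using e[rule_format, of t x] by (auto simp: A_def)
      then show "\<exists>k. \<not> e (Inl (x - 1 - int k, t)) \<and> \<not> e (Inr (x - 1 - int k, t))"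
        by (intro exI[of _ "nat (x - 1 - y)"]) simp
    qed
  qed
qed

text \<open>Both properties pass through \<open>env_speed_shift\<close>: translating the speeds
  amounts to shifting the environment, which preserves \<open>env_measure\<close>, and an invariant
  set of speeds pulls back to a shift-invariant event, to which the zero-one law applies.\<close>

lemma translation_ergodic_env_speed:
  "translation_ergodic (distr (env_measure b\<^sub>1 b\<^sub>2) (Pi\<^sub>M UNIV (\<lambda>_. borel)) env_speed)"
proof -
  let ?E = "env_measure b\<^sub>1 b\<^sub>2" and ?R = "Pi\<^sub>M UNIV (\<lambda>_. borel) :: (int \<Rightarrow> real) measure"
  let ?\<mu> = "distr ?E ?R env_speed"
  interpret prob_space ?E by (rule prob_space_env_measure)
  have T[measurable]: "translation n \<in> ?R \<rightarrow>\<^sub>M ?R" for n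
    unfolding translation_def by (rule measurable_reindex) simp
  have "distr ?\<mu> ?\<mu> (translation n) = ?\<mu>" for n
  proof -
    have "distr ?\<mu> ?\<mu> (translation n) = distr ?\<mu> ?R (translation n)"
      by (rule distr_cong) simp_all
    also have "\<dots> = distr ?E ?R (translation n \<circ> env_speed)"
      by (rule distr_distr) measurable
    also have "translation n \<circ> env_speed = env_speed \<circ> env_shift n"
      by (simp add: fun_eq_iff env_speed_shift)
    also have "distr ?E ?R (env_speed \<circ> env_shift n) = distr (distr ?E ?E (env_shift n)) ?R env_speed"
      by (rule distr_distr[symmetric]) measurable
    finally show ?thesis by (simp add: distr_env_shift)
  qed
  then have "translation_invariant ?\<mu>"
    using T by (simp add: translation_invariant_def)
  moreover have "measure ?\<mu> A = 0 \<or> measure ?\<mu> A = 1"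
    if A: "A \<in> sets ?\<mu>" and A_inv: "\<forall>n. translation n -` A \<inter> space ?\<mu> = A" for A
  proof -
    have "translation n f \<in> A \<longleftrightarrow> f \<in> A" for n f
    proof -
      have "f \<in> space ?\<mu>" by (simp add: space_PiM PiE_UNIV_domain)
      then show ?thesis using A_inv by blast
    qed
    then have "env_shift (int n) -` (env_speed -` A) = env_speed -` A" for n
      by (auto simp: env_speed_shift)
    moreover have "env_speed -` A \<in> sets ?E"
      using measurable_sets[OF measurable_env_speed, of A b\<^sub>1 b\<^sub>2] A by simp
    ultimately show ?thesis
      using env_shift_zero_one[of "env_speed -` A"] A by (simp add: measure_distr)
  qed
  ultimately show ?thesis
    by (simp add: translation_ergodic_def prob_space_distr)
qed

text \<open>Joint independence with prescribed marginals says precisely that the joint law is the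
  product measure, so the abstract families may be replaced by the canonical environment.\<close>

lemma distr_bernoulli_families:
  assumes "prob_space M" and fam: "bernoulli_families M b\<^sub>1 b\<^sub>2 \<chi>\<^sub>1 \<chi>\<^sub>2"
  shows "(\<lambda>\<omega> i. case_sum (case_prod \<chi>\<^sub>1) (case_prod \<chi>\<^sub>2) i \<omega>) \<in> M \<rightarrow>\<^sub>M env_measure b\<^sub>1 b\<^sub>2"
    and "distr M (env_measure b\<^sub>1 b\<^sub>2) (\<lambda>\<omega> i. case_sum (case_prod \<chi>\<^sub>1) (case_prod \<chi>\<^sub>2) i \<omega>) =
      env_measure b\<^sub>1 b\<^sub>2"
proof -
  interpret prob_space M by fact
  let ?X = "case_sum (case_prod \<chi>\<^sub>1) (case_prod \<chi>\<^sub>2)"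
  let ?C = "Pi\<^sub>M UNIV (\<lambda>_. count_space UNIV) :: (site \<Rightarrow> bool) measure"
  have indep: "indep_vars (\<lambda>_. count_space UNIV) ?X UNIV"
    using fam by (simp add: bernoulli_families_def)
  then have X: "?X i \<in> M \<rightarrow>\<^sub>M count_space UNIV" for i
    by (simp add: indep_vars_def)
  have sets: "sets (env_measure b\<^sub>1 b\<^sub>2) = sets ?C"
    unfolding env_measure_def by (rule sets_PiM_cong) (simp_all add: site_law_def)
  show "(\<lambda>\<omega> i. ?X i \<omega>) \<in> M \<rightarrow>\<^sub>M env_measure b\<^sub>1 b\<^sub>2"
    unfolding measurable_cong_sets[OF refl sets] by (rule measurable_PiM_single') (use X in auto)
  have "distr M (env_measure b\<^sub>1 b\<^sub>2) (\<lambda>\<omega> i. ?X i \<omega>) = distr M ?C (\<lambda>\<omega>. \<lambda>i\<in>UNIV. ?X i \<omega>)"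
    by (rule distr_cong) (simp_all add: sets restrict_UNIV)
  also have "\<dots> = Pi\<^sub>M UNIV (\<lambda>i. distr M (count_space UNIV) (?X i))"
    using indep X by (subst (asm) indep_vars_iff_distr_eq_PiM) auto
  also have "\<dots> = env_measure b\<^sub>1 b\<^sub>2"
    unfolding env_measure_def
    by (rule PiM_cong) (use fam in \<open>auto simp: bernoulli_families_def site_law_def split: sum.split\<close>)
  finally show "distr M (env_measure b\<^sub>1 b\<^sub>2) (\<lambda>\<omega> i. ?X i \<omega>) = env_measure b\<^sub>1 b\<^sub>2" .
qed

theorem proposition7p1:
  fixes M :: "'w measure"
    and b\<^sub>1 b\<^sub>2 :: real
    and \<chi>\<^sub>1 \<chi>\<^sub>2 :: "int \<Rightarrow> nat \<Rightarrow> 'w \<Rightarrow> bool"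
    and U :: "int \<Rightarrow> 'w \<Rightarrow> real"
  assumes "prob_space M"
    and "0 < b\<^sub>1" "b\<^sub>1 < b\<^sub>2" "b\<^sub>2 < 1"
    and "bernoulli_families M b\<^sub>1 b\<^sub>2 \<chi>\<^sub>1 \<chi>\<^sub>2"
    and "s6v_speed_process M \<chi>\<^sub>1 \<chi>\<^sub>2 U"
  shows "translation_ergodic (distr M (Pi\<^sub>M UNIV (\<lambda>_::int. borel)) (\<lambda>\<omega> x. U x \<omega>))"
proof -
  let ?E = "env_measure b\<^sub>1 b\<^sub>2" and ?R = "Pi\<^sub>M UNIV (\<lambda>_. borel) :: (int \<Rightarrow> real) measure"
  define X where "X \<omega> i = case_sum (case_prod \<chi>\<^sub>1) (case_prod \<chi>\<^sub>2) i \<omega>" for \<omega> i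
  have X[measurable]: "X \<in> M \<rightarrow>\<^sub>M ?E" and distr_X: "distr M ?E X = ?E"
    using distr_bernoulli_families[OF assms(1,5)] by (simp_all add: X_def[abs_def])
  \<comment> \<open>The cut event has full measure under the law of \<open>X\<close>; pulled back to
    \<open>M\<close>, it is where \<open>env_speed\<close> of the realised environment equals
    \<open>s6v_speed\<close>.\<close>
  have "AE e in distr M ?E X. infinite_left_cuts (\<lambda>x t. e (Inl (x, t))) (\<lambda>x t. e (Inr (x, t)))"
    unfolding distr_X by (rule AE_infinite_left_cuts) (use assms in simp_all)
  from AE_distrD[OF X this] have "AE \<omega> in M. infinite_left_cuts (\<lambda>x t. \<chi>\<^sub>1 x t \<omega>) (\<lambda>x t. \<chi>\<^sub>2 x t \<omega>)"
    by (simp add: X_def)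
  moreover have "AE \<omega> in M. \<forall>x. U x \<omega> = s6v_speed (\<lambda>y t. \<chi>\<^sub>1 y t \<omega>) (\<lambda>y t. \<chi>\<^sub>2 y t \<omega>) x"
    using assms(6) by (simp add: s6v_speed_process_def)
  ultimately have ae: "AE \<omega> in M. (\<lambda>x. U x \<omega>) = (env_speed \<circ> X) \<omega>"
    by eventually_elim (simp add: env_speed_def X_def cut_speed_def fun_eq_iff)
  have "(\<lambda>\<omega> x. U x \<omega>) \<in> M \<rightarrow>\<^sub>M ?R"
    by (rule measurable_PiM_single') (use assms(6) in \<open>auto simp: s6v_speed_process_def\<close>)
  then have "distr M ?R (\<lambda>\<omega> x. U x \<omega>) = distr M ?R (env_speed \<circ> X)"
    using ae measurable_comp[OF X measurable_env_speed] by (intro distr_cong_AE) auto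
  also have "\<dots> = distr ?E ?R env_speed"
    by (subst distr_distr[of env_speed ?E ?R X M, symmetric]) (measurable, simp add: distr_X)
  finally show ?thesis using translation_ergodic_env_speed by simp
qed

end
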